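(* Let $G$ and $G'$ be connected graphs such that $|V(G)|=n$ and $|V(G')|=n-\ell$ for some integer $\ell$ with $1\le \ell<n$. Then $q(G\vee G')\le 2+\ell$.
   Context: All graphs are finite and simple. For a graph $H$ on $m$ vertices, $\mathcal{S}(H)$ is the set of real symmetric $m\times m$ matrices whose off-diagonal entry in position $(i,j)$ is nonzero if and only if $ij$ is an edge of $H$ (diagonal unrestricted); $q(A)$ denotes the number of distinct eigenvalues of a matrix $A$ and $q(H)=\min\{q(A):A\in\mathcal{S}(H)\}$. The join $G\vee G'$ of disjoint graphs $G,G'$ has vertex set $V(G)\cup V(G')$ and edge set $E(G)\cup E(G')\cup\{vv': v\in V(G),v'\in V(G')\}$. *)

theory Defs
  imports "HOL-Analysis.Analysis"
begin

text \<open>A graph whose vertices are the elements of the finite type \<open>'v\<close> is given by its symmetric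
  irreflexive adjacency relation, so each edge \<open>uv\<close> is recorded as both \<open>(u, v)\<close> and \<open>(v, u)\<close>.
  Matrices of a graph are indexed by its vertices.\<close>

definition simple_graph :: "('v::finite \<times> 'v) set \<Rightarrow> bool" where
  "simple_graph E \<longleftrightarrow> sym E \<and> irrefl E"

definition connected_graph :: "('v::finite \<times> 'v) set \<Rightarrow> bool" where
  "connected_graph E \<longleftrightarrow> (\<forall>u v. (u, v) \<in> E\<^sup>*)"

text \<open>The sum type makes the two vertex sets disjoint.\<close>

definition graph_join ::
    "('a::finite \<times> 'a) set \<Rightarrow> ('b::finite \<times> 'b) set \<Rightarrow> (('a + 'b) \<times> ('a + 'b)) set" where
  "graph_join E E' =
     {(Inl u, Inl v) |u v. (u, v) \<in> E} \<union> {(Inr u, Inr v) |u v. (u, v) \<in> E'} \<union>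
     {(Inl u, Inr v) |u v. True} \<union> {(Inr v, Inl u) |u v. True}"

definition graph_matrices :: "('v::finite \<times> 'v) set \<Rightarrow> (real^'v^'v) set" where
  "graph_matrices E =
     {A. transpose A = A \<and> (\<forall>i j. i \<noteq> j \<longrightarrow> (A $ i $ j \<noteq> 0 \<longleftrightarrow> (i, j) \<in> E))}"

definition eigenvalues :: "real^'v^'v \<Rightarrow> real set" where
  "eigenvalues A = {c. \<exists>x. x \<noteq> 0 \<and> A *v x = c *s x}"

definition q_matrix :: "real^'v^'v \<Rightarrow> nat" where
  "q_matrix A = card (eigenvalues A)"

text \<open>On \<open>nat\<close>, the infimum of a nonempty set is its minimum; see \<open>q_graph_attained\<close>.\<close>

definition q_graph :: "('v::finite \<times> 'v) set \<Rightarrow> nat" where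
  "q_graph E = (INF A\<in>graph_matrices E. q_matrix A)"

lemma simple_graph_join:
  "simple_graph E \<Longrightarrow> simple_graph E' \<Longrightarrow> simple_graph (graph_join E E')"
  by (auto simp: simple_graph_def graph_join_def sym_def irrefl_def)

lemma finite_eigenvalues:
  fixes A :: "real^'v^'v"
  assumes "transpose A = A"
  shows "finite (eigenvalues A)"
proof -
  have "\<forall>c\<in>eigenvalues A. \<exists>x. x \<noteq> 0 \<and> A *v x = c *s x"
    by (simp add: eigenvalues_def)
  then obtain f where f: "\<And>c. c \<in> eigenvalues A \<Longrightarrow> f c \<noteq> 0 \<and> A *v f c = c *s f c"
    by metis
  have orth: "f c \<bullet> f d = 0" if "c \<in> eigenvalues A" "d \<in> eigenvalues A" "c \<noteq> d" for c d
  proof -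
    have "(A *v f c) \<bullet> f d = f c \<bullet> (A *v f d)"
      using assms by (metis dot_lmul_matrix vector_transpose_matrix)
    then have "c * (f c \<bullet> f d) = d * (f c \<bullet> f d)"
      using f that by (simp add: scalar_mult_eq_scaleR)
    then show ?thesis using that by simp
  qed
  have inj: "inj_on f (eigenvalues A)"
    using orth f by (metis inj_onI inner_eq_zero_iff)
  have "pairwise orthogonal (f ` eigenvalues A)"
    using orth by (auto simp: pairwise_def orthogonal_def)
  moreover have "0 \<notin> f ` eigenvalues A"
    using f by force
  ultimately have "independent (f ` eigenvalues A)"
    by (rule pairwise_orthogonal_independent)
  then show ?thesis
    using inj finiteI_independent finite_image_iff by blast
qed

lemma graph_matrices_nonempty:
  assumes "simple_graph E"
  shows "graph_matrices E \<noteq> {}"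
proof -
  have "(\<chi> i j. if (i, j) \<in> E then 1 else 0) \<in> graph_matrices E"
    using assms
    by (auto simp: graph_matrices_def simple_graph_def transpose_def vec_eq_iff sym_def)
  then show ?thesis by blast
qed

lemma q_graph_attained:
  assumes "simple_graph E"
  shows "\<exists>A\<in>graph_matrices E. q_graph E = q_matrix A"
  using Inf_nat_def1[of "q_matrix ` graph_matrices E"] graph_matrices_nonempty[OF assms]
  by (auto simp: q_graph_def)

end

theory Submission
  imports Defs
begin

text \<open>Place both graphs on the vertices of \<open>G\<close>, leaving a vertex \<open>k\<close> outside \<open>G'\<close>. A small
  multiple of the adjacency matrix added to a diagonal matrix gives a matrix \<open>A\<close> of \<open>G\<close> and a
  matrix \<open>C\<close> of \<open>G'\<close> (padded with isolated vertices), with eigenbases close to the standard basis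
  and with the eigenvalues \<open>s\<close> of \<open>C\<close> strictly interlacing the numbers \<open>\<delta> = c - t\<close>, where \<open>t\<close>
  are the eigenvalues of \<open>A\<close>. Interlacing yields a vector \<open>z\<close> such that \<open>diag \<delta> + z z\<^sup>T\<close> has the
  spectrum \<open>s\<close>. Hence there are square matrices with \<open>X X\<^sup>T = A\<close>, \<open>Y Y\<^sup>T = C\<close> and
  \<open>X\<^sup>T X + Y\<^sup>T Y = c I + z z\<^sup>T\<close>. As the perturbation vanishes, the entries of \<open>X Y\<^sup>T\<close> tend to those of
  a Cauchy-like matrix, so outside column \<open>k\<close> they do not vanish. Row \<open>k\<close> of \<open>Y\<close> is zero because
  row \<open>k\<close> of \<open>C\<close> is. Deleting this row and the other \<open>l - 1\<close> rows outside \<open>G'\<close> turns \<open>c I + z z\<^sup>T\<close>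
  into a matrix that differs from \<open>c I\<close> by rank at most \<open>l\<close>, so the Gram matrix of the remaining
  rows of \<open>X\<close> and \<open>Y\<close> has at most \<open>l\<close> eigenvalues besides \<open>0\<close> and \<open>c\<close>.\<close>

section \<open>Eigenvalue counts\<close>

lemma mat_mult_vector: "mat c *v x = c *\<^sub>R x" for x :: "real^'n"
  by (simp add: vec_eq_iff matrix_vector_mult_def mat_def if_distrib[of "\<lambda>z. z * _"] cong: if_cong)

lemma eigenvalues_iff: "c \<in> eigenvalues A \<longleftrightarrow> (\<exists>x. x \<noteq> 0 \<and> A *v x = c *\<^sub>R x)"
  by (simp add: eigenvalues_def scalar_mult_eq_scaleR)

lemma eigenvectors_orthogonal:
  fixes A :: "real^'n^'n"
  assumes "transpose A = A" "A *v x = s *\<^sub>R x" "A *v y = t *\<^sub>R y" "s \<noteq> t"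
  shows "orthogonal x y"
proof -
  have "(A *v x) \<bullet> y = x \<bullet> (A *v y)"
    using assms(1) by (metis dot_lmul_matrix vector_transpose_matrix)
  then show ?thesis using assms(2-) by (simp add: orthogonal_def)
qed

lemma q_matrix_le_rank:
  fixes A :: "real^'n^'n"
  assumes "transpose A = A"
  shows "q_matrix A \<le> 1 + rank (A - mat c)"
proof -
  define S where "S = eigenvalues A - {c}"
  obtain f where nonzero: "f t \<noteq> 0" and eigenvector: "A *v f t = t *\<^sub>R f t" if "t \<in> S" for t
    unfolding S_def by (metis DiffD1 eigenvalues_iff)
  have orth: "orthogonal (f s) (f t)" if "s \<in> S" "t \<in> S" "s \<noteq> t" for s t
    using eigenvectors_orthogonal[OF assms eigenvector eigenvector] that by blast
  have inj: "inj_on f S"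
    using orth nonzero by (metis inj_onI orthogonal_self)
  have "independent (f ` S)"
    using orth nonzero by (intro pairwise_orthogonal_independent) (auto simp: pairwise_def)
  moreover have "f ` S \<subseteq> range (\<lambda>x. (A - mat c) *v x)"
  proof
    fix y assume "y \<in> f ` S"
    then obtain t where "t \<in> S" "y = f t" by blast
    then have "y = (A - mat c) *v ((1 / (t - c)) *\<^sub>R y)"
      by (simp add: S_def matrix_vector_mult_diff_rdistrib mat_mult_vector matrix_vector_mult_scaleR
          eigenvector scaleR_diff_right[symmetric] scaleR_diff_left[symmetric])
    then show "y \<in> range (\<lambda>x. (A - mat c) *v x)" by blast
  qed
  ultimately have "card (f ` S) \<le> rank (A - mat c)"
    by (simp add: rank_dim_range independent_card_le_dim)
  then have "card S \<le> rank (A - mat c)"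
    by (simp add: card_image[OF inj])
  moreover have "card (eigenvalues A) \<le> 1 + card S"
    using card_Diff1_le[of "eigenvalues A" c] finite_eigenvalues[OF assms]
    by (auto simp: S_def card_Diff_singleton_if)
  ultimately show ?thesis by (simp add: q_matrix_def)
qed

lemma eigenvalues_mult_commute_subset:
  fixes A :: "real^'n^'m" and B :: "real^'m^'n"
  shows "eigenvalues (A ** B) \<subseteq> insert 0 (eigenvalues (B ** A))"
proof
  fix t assume "t \<in> eigenvalues (A ** B)"
  then obtain x where x: "x \<noteq> 0" "A *v (B *v x) = t *\<^sub>R x"
    by (auto simp: eigenvalues_iff matrix_vector_mul_assoc)
  show "t \<in> insert 0 (eigenvalues (B ** A))"
  proof (cases "t = 0")
    case False
    then have "B *v x \<noteq> 0" using x by auto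
    moreover have "(B ** A) *v (B *v x) = t *\<^sub>R (B *v x)"
      by (simp add: matrix_vector_mul_assoc[symmetric] x(2) matrix_vector_mult_scaleR)
    ultimately show ?thesis by (auto simp: eigenvalues_iff)
  qed simp
qed

lemma q_matrix_gram_le:
  fixes K :: "real^'n^'m"
  shows "q_matrix (K ** transpose K) \<le> 2 + rank (transpose K ** K - mat c)"
proof -
  have symmetric: "transpose (transpose K ** K) = transpose K ** K"
    by (simp add: matrix_transpose_mul)
  have finite: "finite (eigenvalues (transpose K ** K))"
    by (rule finite_eigenvalues[OF symmetric])
  have "q_matrix (K ** transpose K) \<le> card (insert 0 (eigenvalues (transpose K ** K)))"
    unfolding q_matrix_def using finite by (intro card_mono eigenvalues_mult_commute_subset) simp
  also have "\<dots> \<le> 1 + q_matrix (transpose K ** K)"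
    using finite by (simp add: q_matrix_def card_insert_if)
  also have "\<dots> \<le> 2 + rank (transpose K ** K - mat c)"
    using q_matrix_le_rank[OF symmetric, of c] by simp
  finally show ?thesis .
qed

section \<open>Orthogonal diagonalization\<close>

definition diag :: "real^'n \<Rightarrow> real^'n^'n" where
  "diag d = (\<chi> i j. if i = j then d $ i else 0)"

definition orthogonally_diagonalizes :: "real^'n^'n \<Rightarrow> real^'n \<Rightarrow> real^'n^'n \<Rightarrow> bool" where
  "orthogonally_diagonalizes U t A \<longleftrightarrow> orthogonal_matrix U \<and> A = U ** diag t ** transpose U"

definition sqrt_factor :: "real^'n \<Rightarrow> real^'n^'n \<Rightarrow> real^'n^'n \<Rightarrow> real^'n^'n" where
  "sqrt_factor t U W = U ** diag (\<chi> i. sqrt (t $ i)) ** transpose W"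

lemma transpose_diag [simp]: "transpose (diag d) = diag d"
  by (auto simp: transpose_def diag_def vec_eq_iff)

lemma diag_mult_vector_nth: "(diag d *v x) $ i = d $ i * x $ i"
  by (simp add: matrix_vector_mult_def diag_def if_distrib[of "\<lambda>z. z * _"] cong: if_cong)

lemma diag_mult_nth: "(diag d ** A) $ i $ j = d $ i * A $ i $ j"
  by (simp add: matrix_matrix_mult_def diag_def if_distrib[of "\<lambda>z. z * _"] cong: if_cong)

lemma mult_diag_nth: "(A ** diag d) $ i $ j = A $ i $ j * d $ j"
  by (simp add: matrix_matrix_mult_def diag_def if_distrib[of "\<lambda>z. _ * z"] cong: if_cong)

lemma eigenbasis_orthogonally_diagonalizes:
  assumes "transpose A = A" and "inj (($) t)" and "\<And>j. norm (column j U) = 1"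
    and eigen: "\<And>j. A *v column j U = t $ j *\<^sub>R column j U"
  shows "orthogonally_diagonalizes U t A"
proof -
  have "orthogonal (column i U) (column j U)" if "i \<noteq> j" for i j
    using eigenvectors_orthogonal[OF assms(1) eigen eigen] assms(2) that by (auto dest: injD)
  then have U: "orthogonal_matrix U"
    using assms(3) by (simp add: orthogonal_matrix_orthonormal_columns)
  have "(A ** U) $ i $ j = (U ** diag t) $ i $ j" for i j
  proof -
    have "(A ** U) $ i $ j = (A *v column j U) $ i"
      by (simp add: matrix_matrix_mult_def matrix_vector_mult_def column_def)
    also have "\<dots> = (U ** diag t) $ i $ j"
      unfolding eigen by (simp add: mult_diag_nth column_def)
    finally show ?thesis .
  qed
  then have "A ** U = U ** diag t" by (simp add: vec_eq_iff)
  then have "A ** (U ** transpose U) = U ** diag t ** transpose U"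
    by (simp add: matrix_mul_assoc)
  then show ?thesis
    using U by (simp add: orthogonally_diagonalizes_def orthogonal_matrix_def)
qed

lemma eigenvalue_eq_zero:
  assumes "orthogonally_diagonalizes U t A" and "A $ i = 0" and "U $ i $ j \<noteq> 0"
  shows "t $ j = 0"
proof -
  have "A ** U = U ** diag t"
    using assms(1)
    by (simp add: orthogonally_diagonalizes_def orthogonal_matrix_def matrix_mul_assoc[symmetric])
  then have "U $ i $ j * t $ j = (A ** U) $ i $ j" by (simp add: mult_diag_nth)
  also have "\<dots> = 0" by (simp add: matrix_matrix_mult_def assms(2))
  finally show ?thesis using assms(3) by simp
qed

lemma diag_orthogonally_diagonalizes: "orthogonally_diagonalizes (mat 1) t (diag t)"
  by (simp add: orthogonally_diagonalizes_def orthogonal_matrix_id)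

lemma orthogonally_diagonalizes_conjugate:
  assumes "orthogonally_diagonalizes U t A"
  shows "transpose U ** A ** U = diag t"
proof -
  have "transpose U ** A ** U = (transpose U ** U) ** diag t ** (transpose U ** U)"
    using assms by (simp add: orthogonally_diagonalizes_def matrix_mul_assoc)
  then show ?thesis
    using assms by (simp add: orthogonally_diagonalizes_def orthogonal_matrix_def)
qed

lemma transpose_sqrt_factor: "transpose (sqrt_factor t U W) = sqrt_factor t W U"
  by (simp add: sqrt_factor_def matrix_transpose_mul matrix_mul_assoc)

lemma sqrt_factor_mult_transpose:
  assumes "orthogonally_diagonalizes U t A" and "orthogonal_matrix W" and "\<And>i. 0 \<le> t $ i"
  shows "sqrt_factor t U W ** transpose (sqrt_factor t U W) = A"
proof -
  define R where "R = diag (\<chi> i. sqrt (t $ i))"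
  have "R ** R = diag t"
    using assms(3) by (auto simp: vec_eq_iff R_def diag_mult_nth) (auto simp: diag_def)
  moreover have "sqrt_factor t U W ** transpose (sqrt_factor t U W)
      = U ** (R ** (transpose W ** W) ** R) ** transpose U"
    by (simp add: sqrt_factor_def R_def[symmetric] matrix_transpose_mul matrix_mul_assoc)
      (simp add: R_def)
  ultimately show ?thesis
    using assms(1,2) by (simp add: orthogonally_diagonalizes_def orthogonal_matrix_def)
qed

lemma tendsto_matrix_mult [tendsto_intros]:
  fixes A :: "'x \<Rightarrow> real^'n^'m" and B :: "'x \<Rightarrow> real^'p^'n"
  assumes "(A \<longlongrightarrow> A0) F" and "(B \<longlongrightarrow> B0) F"
  shows "((\<lambda>x. A x ** B x) \<longlongrightarrow> A0 ** B0) F"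
  unfolding matrix_matrix_mult_def by (intro tendsto_intros assms)

lemma tendsto_transpose [tendsto_intros]:
  assumes "(A \<longlongrightarrow> A0) F"
  shows "((\<lambda>x. transpose (A x)) \<longlongrightarrow> transpose A0) F"
  unfolding transpose_def by (intro tendsto_intros assms)

lemma tendsto_diag [tendsto_intros]:
  assumes "(d \<longlongrightarrow> d0) F"
  shows "((\<lambda>x. diag (d x)) \<longlongrightarrow> diag d0) F"
proof -
  have "((\<lambda>x. diag (d x) $ i $ j) \<longlongrightarrow> diag d0 $ i $ j) F" for i j
    by (cases "i = j") (auto simp: diag_def intro: tendsto_intros assms)
  then show ?thesis by (intro vec_tendstoI)
qed

lemma tendsto_mat [tendsto_intros]:
  fixes f :: "'x \<Rightarrow> real"
  assumes "(f \<longlongrightarrow> c) F"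
  shows "((\<lambda>x. mat (f x) :: real^'n^'n) \<longlongrightarrow> mat c) F"
proof -
  have "(mat a :: real^'n^'n) = diag (\<chi> i. a)" for a
    by (simp add: mat_def diag_def vec_eq_iff)
  then show ?thesis by (simp add: tendsto_diag tendsto_vec_lambda assms)
qed

lemma tendsto_sqrt_factor [tendsto_intros]:
  assumes "(t \<longlongrightarrow> t0) F" and "(U \<longlongrightarrow> U0) F" and "(W \<longlongrightarrow> W0) F"
  shows "((\<lambda>x. sqrt_factor (t x) (U x) (W x)) \<longlongrightarrow> sqrt_factor t0 U0 W0) F"
  unfolding sqrt_factor_def by (intro tendsto_intros assms)

section \<open>Rank-one updates with prescribed spectrum\<close>

lemma lagrange_interpolation:
  fixes p :: "'a::field poly"
  assumes "finite I" and "inj_on x I" and "degree p < card I"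
  shows "poly p y = (\<Sum>i\<in>I. poly p (x i) * (\<Prod>k\<in>I-{i}. (y - x k) / (x i - x k)))"
proof -
  define basis where "basis i = (\<Prod>k\<in>I-{i}. smult (1 / (x i - x k)) [:- x k, 1:])" for i
  define q where "q = (\<Sum>i\<in>I. smult (poly p (x i)) (basis i))"
  have poly_basis: "poly (basis i) z = (\<Prod>k\<in>I-{i}. (z - x k) / (x i - x k))" for i z
    by (simp add: basis_def poly_prod diff_divide_distrib)
  have "degree (basis i) < card I" if "i \<in> I" for i
  proof -
    have "degree (basis i) \<le> (\<Sum>k\<in>I-{i}. 1)"
      unfolding basis_def using assms(1)
      by (intro order.trans[OF degree_prod_sum_le] sum_mono) auto
    also have "\<dots> < card I"
      using card_Diff1_less[OF assms(1) that] by simp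
    finally show ?thesis .
  qed
  then have "degree q < card I"
    unfolding q_def using assms(3) by (intro degree_sum_less le_less_trans[OF degree_smult_le]) auto
  moreover have "poly p z = poly q z" if "z \<in> x ` I" for z
  proof -
    obtain j where j: "j \<in> I" "z = x j" using \<open>z \<in> x ` I\<close> by blast
    have "poly (basis i) (x j) = (if i = j then 1 else 0)" if "i \<in> I" for i
      using that j(1) assms(1,2) by (auto simp: poly_basis inj_on_eq_iff intro!: prod.neutral)
    then have "poly q z = (\<Sum>i\<in>I. poly p (x i) * (if i = j then 1 else 0))"
      by (simp add: q_def poly_sum j(2))
    then show ?thesis
      using assms(1) j by (simp add: if_distrib cong: if_cong)
  qed
  ultimately have "p = q"
    using assms(2,3) by (intro poly_eqI_degree[of "x ` I"]) (auto simp: card_image)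
  then have "poly p y = poly q y" by (rule arg_cong)
  also have "\<dots> = (\<Sum>i\<in>I. poly p (x i) * (\<Prod>k\<in>I-{i}. (y - x k) / (x i - x k)))"
    by (simp only: q_def poly_sum poly_smult poly_basis)
  finally show ?thesis .
qed

lemma degree_diff_monic_less:
  fixes p q :: "'a::comm_ring_1 poly"
  assumes "degree p = n" and "degree q = n" and "lead_coeff p = 1" and "lead_coeff q = 1"
    and "0 < n"
  shows "degree (p - q) < n"
proof -
  have "coeff (p - q) n = 0" and "degree (p - q) \<le> n"
    using assms by (auto intro: degree_diff_le)
  then show ?thesis
    using assms(5) by (metis eq_zero_or_degree_less degree_0)
qed

lemma prod_linear_quotient_partial_fractions:
  fixes d m :: "'i \<Rightarrow> 'a::field"
  assumes "finite I" and "inj_on d I" and "\<And>i. i \<in> I \<Longrightarrow> x \<noteq> d i"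
  shows "(\<Prod>k\<in>I. (x - m k) / (x - d k))
    = 1 - (\<Sum>i\<in>I. (m i - d i) * (\<Prod>k\<in>I-{i}. (d i - m k) / (d i - d k)) / (x - d i))"
proof (cases "I = {}")
  case False
  define root_poly where "root_poly f = (\<Prod>k\<in>I. [:- f k, 1:])" for f :: "'i \<Rightarrow> 'a"
  have "degree (root_poly f) = card I" "lead_coeff (root_poly f) = 1" for f
    by (simp add: root_poly_def degree_prod_eq_sum_degree) (simp only: root_poly_def lead_coeff_prod, simp)
  then have degree: "degree (root_poly d - root_poly m) < card I"
    using False assms(1) by (intro degree_diff_monic_less) (auto simp: card_gt_0_iff)
  have poly_root_poly: "poly (root_poly f) z = (\<Prod>k\<in>I. z - f k)" for f z
    by (simp add: root_poly_def poly_prod)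
  have nonzero: "poly (root_poly d) x \<noteq> 0"
    using assms(1,3) by (simp add: poly_root_poly)
  have summand: "poly (root_poly d - root_poly m) (d i) * (\<Prod>k\<in>I-{i}. (x - d k) / (d i - d k))
      = poly (root_poly d) x * ((m i - d i) * (\<Prod>k\<in>I-{i}. (d i - m k) / (d i - d k)) / (x - d i))"
    if "i \<in> I" for i
  proof -
    have "poly (root_poly d - root_poly m) (d i) = (m i - d i) * (\<Prod>k\<in>I-{i}. d i - m k)"
      using assms(1) that by (simp add: poly_root_poly prod.remove[of I i] algebra_simps)
    moreover have "poly (root_poly d) x = (x - d i) * (\<Prod>k\<in>I-{i}. x - d k)"
      using assms(1) that by (simp add: poly_root_poly prod.remove[of I i])
    ultimately show ?thesis
      using assms(3)[OF that] by (simp add: prod_dividef)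
  qed
  have "poly (root_poly d) x - poly (root_poly m) x = poly (root_poly d) x *
      (\<Sum>i\<in>I. (m i - d i) * (\<Prod>k\<in>I-{i}. (d i - m k) / (d i - d k)) / (x - d i))"
    using lagrange_interpolation[OF assms(1,2) degree, of x]
    by (simp only: summand sum_distrib_left cong: sum.cong) simp
  then have "poly (root_poly m) x / poly (root_poly d) x
      = 1 - (\<Sum>i\<in>I. (m i - d i) * (\<Prod>k\<in>I-{i}. (d i - m k) / (d i - d k)) / (x - d i))"
    using nonzero by (simp add: field_simps)
  then show ?thesis
    by (simp add: poly_root_poly prod_dividef)
qed simp

text \<open>Up to a simultaneous reordering of the coordinates, \<open>d 1 < m 1 < d 2 < m 2 < \<dots>\<close>.\<close>

definition interlacing :: "real^'n \<Rightarrow> real^'n \<Rightarrow> bool" where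
  "interlacing d m \<longleftrightarrow>
     (\<forall>i. d $ i < m $ i) \<and> (\<forall>i j. i \<noteq> j \<longrightarrow> m $ i < d $ j \<or> m $ j < d $ i)"

lemma interlacingD:
  assumes "interlacing d m"
  shows "d $ i < m $ i" and "i \<noteq> j \<Longrightarrow> m $ i < d $ j \<or> m $ j < d $ i"
  using assms by (auto simp: interlacing_def)

lemma interlacing_distinct:
  assumes "interlacing d m"
  shows "inj (($) d)" and "inj (($) m)" and "m $ j \<noteq> d $ i"
proof -
  have "d $ i \<noteq> d $ j \<and> m $ i \<noteq> m $ j" if "i \<noteq> j" for i j
    using interlacingD(1)[OF assms, of i] interlacingD(1)[OF assms, of j]
      interlacingD(2)[OF assms that] by auto
  then show "inj (($) d)" "inj (($) m)" by (auto intro: injI)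
  show "m $ j \<noteq> d $ i"
    using interlacingD(1)[OF assms, of i] interlacingD(1)[OF assms, of j]
      interlacingD(2)[OF assms, of i j] by (cases "i = j") auto
qed

lemma tendsto_imp_eventually_less:
  fixes f g :: "'x \<Rightarrow> 'a::{dense_linorder, linorder_topology}"
  assumes "(f \<longlongrightarrow> a) F" and "(g \<longlongrightarrow> b) F" and "a < b"
  shows "\<forall>\<^sub>F x in F. f x < g x"
proof -
  obtain c where "a < c" "c < b" using dense[OF assms(3)] by blast
  with order_tendstoD(2)[OF assms(1)] order_tendstoD(1)[OF assms(2)]
  have "\<forall>\<^sub>F x in F. f x < c" and "\<forall>\<^sub>F x in F. c < g x" by blast+
  then show ?thesis by eventually_elim (rule less_trans)
qed

lemma interlacing_eventually:
  assumes "(d \<longlongrightarrow> d0) F" and "(m \<longlongrightarrow> m0) F" and "interlacing d0 m0"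
  shows "\<forall>\<^sub>F x in F. interlacing (d x) (m x)"
proof -
  have "\<forall>\<^sub>F x in F. d x $ i < m x $ i" for i
    by (rule tendsto_imp_eventually_less[OF assms(1,2)[THEN tendsto_vec_nth]
          interlacingD(1)[OF assms(3)]])
  moreover have "\<forall>\<^sub>F x in F. i \<noteq> j \<longrightarrow> m x $ i < d x $ j \<or> m x $ j < d x $ i" for i j
  proof (cases "i = j")
    case False
    then consider "m0 $ i < d0 $ j" | "m0 $ j < d0 $ i"
      using interlacingD(2)[OF assms(3)] by blast
    then show ?thesis
      by cases (auto elim!: eventually_mono
          dest!: tendsto_imp_eventually_less[OF assms(2,1)[THEN tendsto_vec_nth]])
  qed simp
  ultimately show ?thesis
    unfolding interlacing_def by (intro eventually_conj eventually_all_finite)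
qed

text \<open>Minus the residue at \<open>d i\<close> of the rational function with zeros \<open>m\<close> and poles \<open>d\<close>.\<close>

definition secular_weight :: "real^'n \<Rightarrow> real^'n \<Rightarrow> 'n \<Rightarrow> real" where
  "secular_weight d m i = (m $ i - d $ i) * (\<Prod>k\<in>UNIV-{i}. (d $ i - m $ k) / (d $ i - d $ k))"

definition secular_root :: "real^'n \<Rightarrow> real^'n \<Rightarrow> real^'n" where
  "secular_root d m = (\<chi> i. sqrt (secular_weight d m i))"

definition secular_vector :: "real^'n \<Rightarrow> real^'n \<Rightarrow> 'n \<Rightarrow> real^'n" where
  "secular_vector d m j = (\<chi> i. secular_root d m $ i / (m $ j - d $ i))"

definition secular_matrix :: "real^'n \<Rightarrow> real^'n \<Rightarrow> real^'n^'n" where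
  "secular_matrix d m = (\<chi> i j. sgn (secular_vector d m j) $ i)"

definition outer :: "real^'n \<Rightarrow> real^'m \<Rightarrow> real^'m^'n" where
  "outer x y = (\<chi> i j. x $ i * y $ j)"

lemma outer_mult_vector: "outer x y *v v = (y \<bullet> v) *\<^sub>R x"
  by (simp add: outer_def matrix_vector_mult_def inner_vec_def vec_eq_iff sum_distrib_left mult_ac)

lemma secular_equation:
  assumes "interlacing d m"
  shows "(\<Sum>i\<in>UNIV. secular_weight d m i / (m $ j - d $ i)) = 1"
proof -
  have "(\<Prod>k\<in>UNIV. (m $ j - m $ k) / (m $ j - d $ k)) = 0"
    by (intro prod_zero) auto
  then show ?thesis
    using prod_linear_quotient_partial_fractions[of UNIV "($) d" "m $ j" "($) m"]
      interlacing_distinct[OF assms]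
    by (simp add: secular_weight_def)
qed

lemma secular_weight_pos:
  assumes "interlacing d m"
  shows "0 < secular_weight d m i"
proof -
  have "0 < (d $ i - m $ k) / (d $ i - d $ k)" if "k \<noteq> i" for k
    using interlacingD(1)[OF assms, of i] interlacingD(1)[OF assms, of k]
      interlacingD(2)[OF assms that] by (auto simp: zero_less_divide_iff)
  then have "0 < (\<Prod>k\<in>UNIV-{i}. (d $ i - m $ k) / (d $ i - d $ k))"
    by (intro prod_pos) simp
  then show ?thesis
    using interlacingD(1)[OF assms, of i] by (simp add: secular_weight_def)
qed

lemma secular_vector_nth_nonzero:
  assumes "interlacing d m"
  shows "secular_vector d m j $ i \<noteq> 0"
  using secular_weight_pos[OF assms, of i] interlacing_distinct(3)[OF assms, of j i]
  by (simp add: secular_vector_def secular_root_def)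

lemma secular_vector_nonzero:
  assumes "interlacing d m"
  shows "secular_vector d m j \<noteq> 0"
  using secular_vector_nth_nonzero[OF assms, of j j] by auto

lemma secular_matrix_nth_nonzero:
  assumes "interlacing d m"
  shows "secular_matrix d m $ i $ j \<noteq> 0"
  using secular_vector_nth_nonzero[OF assms] secular_vector_nonzero[OF assms]
  by (simp add: secular_matrix_def sgn_div_norm)

lemma secular_vector_eigenvector:
  assumes "interlacing d m"
  defines "z \<equiv> secular_root d m"
  shows "(diag d + outer z z) *v secular_vector d m j = m $ j *\<^sub>R secular_vector d m j"
proof -
  have "z \<bullet> secular_vector d m j = (\<Sum>i\<in>UNIV. secular_weight d m i / (m $ j - d $ i))"
    using secular_weight_pos[OF assms(1)]
    by (simp add: inner_vec_def secular_vector_def z_def secular_root_def less_imp_le)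
  then have "z \<bullet> secular_vector d m j = 1"
    by (simp add: secular_equation[OF assms(1)])
  moreover have "d $ i * (z $ i / (m $ j - d $ i)) + z $ i = m $ j * (z $ i / (m $ j - d $ i))" for i
    using interlacing_distinct(3)[OF assms(1), of j i] by (simp add: field_simps)
  ultimately show ?thesis
    by (simp add: vec_eq_iff matrix_vector_mult_add_rdistrib outer_mult_vector diag_mult_vector_nth)
      (simp add: secular_vector_def z_def)
qed

lemma secular_matrix_orthogonally_diagonalizes:
  assumes "interlacing d m"
  defines "z \<equiv> secular_root d m"
  shows "orthogonally_diagonalizes (secular_matrix d m) m (diag d + outer z z)"
proof (rule eigenbasis_orthogonally_diagonalizes)
  have column: "column j (secular_matrix d m) = sgn (secular_vector d m j)" for j
    by (simp add: secular_matrix_def column_def)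
  show "transpose (diag d + outer z z) = diag d + outer z z"
    by (simp add: vec_eq_iff transpose_def diag_def outer_def mult.commute)
  show "inj (($) m)" by (rule interlacing_distinct[OF assms(1)])
  show "norm (column j (secular_matrix d m)) = 1" for j
    by (simp add: column norm_sgn secular_vector_nonzero[OF assms(1)])
  show "(diag d + outer z z) *v column j (secular_matrix d m)
      = m $ j *\<^sub>R column j (secular_matrix d m)" for j
    by (simp add: column sgn_div_norm matrix_vector_mult_scaleR z_def
        secular_vector_eigenvector[OF assms(1)])
qed

lemma tendsto_secular_matrix:
  assumes "(d \<longlongrightarrow> d0) F" and "(m \<longlongrightarrow> m0) F" and "interlacing d0 m0"
  shows "((\<lambda>x. secular_matrix (d x) (m x)) \<longlongrightarrow> secular_matrix d0 m0) F"
proof -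
  have "((\<lambda>x. secular_vector (d x) (m x) j) \<longlongrightarrow> secular_vector d0 m0 j) F" for j
    unfolding secular_vector_def secular_root_def secular_weight_def
    using interlacing_distinct[OF assms(3)]
    by (simp, intro tendsto_intros assms(1,2)) (auto dest: injD)
  then show ?thesis
    unfolding secular_matrix_def
    by (intro tendsto_intros secular_vector_nonzero[OF assms(3)])
qed

section \<open>Small perturbations of a diagonal matrix\<close>

lemma tendsto_det [tendsto_intros]:
  fixes A :: "'x \<Rightarrow> real^'n^'n"
  assumes "(A \<longlongrightarrow> A0) F"
  shows "((\<lambda>x. det (A x)) \<longlongrightarrow> det A0) F"
  unfolding det_def by (intro tendsto_intros assms)

lemma eventually_root_of_sign_change:
  fixes g :: "'x \<Rightarrow> real \<Rightarrow> real"
  assumes "a \<le> b" and cont: "\<And>x. continuous_on {a..b} (g x)"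
    and "((\<lambda>x. g x a) \<longlongrightarrow> p) F" and "((\<lambda>x. g x b) \<longlongrightarrow> q) F" and "p * q < 0"
  shows "\<forall>\<^sub>F x in F. \<exists>t\<in>{a..b}. g x t = 0"
proof -
  have "((\<lambda>x. g x a * g x b) \<longlongrightarrow> p * q) F"
    by (intro tendsto_intros assms)
  then have "\<forall>\<^sub>F x in F. g x a * g x b < 0"
    using assms(5) by (rule order_tendstoD)
  then show ?thesis
  proof eventually_elim
    case (elim x)
    then consider "g x a \<le> 0" "0 \<le> g x b" | "0 \<le> g x a" "g x b \<le> 0"
      by (auto simp: mult_less_0_iff)
    then show ?case
      using IVT'[of "g x" a 0 b] IVT2'[of "g x" b 0 a] assms(1) cont by cases auto
  qed
qed

lemma det_diag_minus_mat: "det (diag d - mat t) = (\<Prod>i\<in>UNIV. d $ i - t)"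
  by (subst det_diagonal) (auto simp: diag_def mat_def)

lemma det_diag_sign_change:
  assumes "0 < r" and "\<And>k. k \<noteq> i \<Longrightarrow> r < \<bar>d $ k - d $ i\<bar>"
  shows "det (diag d - mat (d $ i - r)) * det (diag d - mat (d $ i + r)) < 0"
proof -
  have "det (diag d - mat (d $ i - r)) * det (diag d - mat (d $ i + r))
      = (\<Prod>k\<in>UNIV. (d $ k - d $ i)\<^sup>2 - r\<^sup>2)"
    by (simp add: det_diag_minus_mat prod.distrib[symmetric] power2_eq_square algebra_simps)
  also have "\<dots> = - r\<^sup>2 * (\<Prod>k\<in>UNIV-{i}. (d $ k - d $ i)\<^sup>2 - r\<^sup>2)"
    by (simp add: prod.remove[of UNIV i])
  also have "\<dots> < 0"
  proof -
    have "r\<^sup>2 < (d $ k - d $ i)\<^sup>2" if "k \<noteq> i" for k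
      using power_strict_mono[OF assms(2)[OF that], of 2] assms(1) by simp
    then have "0 < (\<Prod>k\<in>UNIV-{i}. (d $ k - d $ i)\<^sup>2 - r\<^sup>2)"
      by (intro prod_pos) simp
    then show ?thesis using assms(1) by simp
  qed
  finally show ?thesis .
qed

lemma singular_imp_eigenvector:
  fixes A :: "real^'n^'n"
  assumes "det (A - mat t) = 0"
  obtains u where "norm u = 1" and "A *v u = t *\<^sub>R u" and "0 \<le> u $ i"
proof -
  have "\<not> invertible (A - mat t)" using assms by (simp add: invertible_det_nz)
  then obtain x where x: "x \<noteq> 0" "(A - mat t) *v x = 0"
    using matrix_left_invertible_ker[of "A - mat t"] invertible_left_inverse[of "A - mat t"] by blast
  then have eigen: "A *v x = t *\<^sub>R x"
    by (simp add: matrix_vector_mult_diff_rdistrib mat_mult_vector)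
  define s where "s = (if 0 \<le> x $ i then 1 / norm x else - 1 / norm x)"
  show ?thesis
  proof
    show "norm (s *\<^sub>R x) = 1" using x(1) by (simp add: s_def)
    show "A *v (s *\<^sub>R x) = t *\<^sub>R (s *\<^sub>R x)"
      by (simp add: eigen matrix_vector_mult_scaleR)
    show "0 \<le> (s *\<^sub>R x) $ i" by (auto simp: s_def divide_nonpos_nonneg)
  qed
qed

lemma eventually_eigenpair_near_diagonal:
  fixes E :: "real^'n^'n"
  assumes "0 < r" and "\<And>k. k \<noteq> i \<Longrightarrow> r < \<bar>d $ k - d $ i\<bar>"
  shows "\<forall>\<^sub>F e in at 0. \<exists>t u. \<bar>t - d $ i\<bar> \<le> r \<and> norm u = 1 \<and> 0 \<le> u $ i \<and>
    (diag d + e *\<^sub>R E) *v u = t *\<^sub>R u"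
proof -
  define g where "g e t = det (diag d + e *\<^sub>R E - mat t)" for e t
  have cont: "continuous_on X (g e)" for X e
    unfolding continuous_on_def g_def by (intro ballI tendsto_intros)
  have lim: "((\<lambda>e. g e t) \<longlongrightarrow> det (diag d - mat t)) (at 0)" for t
  proof -
    have "((\<lambda>e. g e t) \<longlongrightarrow> det (diag d + 0 *\<^sub>R E - mat t)) (at 0)"
      unfolding g_def by (intro tendsto_intros)
    then show ?thesis by simp
  qed
  have "\<forall>\<^sub>F e in at 0. \<exists>t\<in>{d $ i - r..d $ i + r}. g e t = 0"
    using assms(1)
    by (intro eventually_root_of_sign_change[OF _ cont lim lim] det_diag_sign_change assms(2)) auto
  then show ?thesis
  proof eventually_elim
    case (elim e)
    then obtain t where t: "\<bar>t - d $ i\<bar> \<le> r" "det (diag d + e *\<^sub>R E - mat t) = 0"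
      unfolding g_def abs_diff_le_iff by auto
    from t(2) obtain u where "norm u = 1" "(diag d + e *\<^sub>R E) *v u = t *\<^sub>R u" "0 \<le> u $ i"
      by (rule singular_imp_eigenvector)
    with t(1) show ?case by blast
  qed
qed

lemma perturbed_eigenvector_nth_le:
  fixes E :: "real^'n^'n"
  assumes eigen: "(diag d + e *\<^sub>R E) *v u = t *\<^sub>R u" and "norm u = 1"
  shows "\<bar>t - d $ k\<bar> * \<bar>u $ k\<bar> \<le> \<bar>e\<bar> * onorm ((*v) E)"
proof -
  have "t * u $ k = d $ k * u $ k + e * (E *v u) $ k"
    using arg_cong[OF eigen, of "\<lambda>x. x $ k"]
    by (simp add: matrix_vector_mult_add_rdistrib diag_mult_vector_nth
        scaleR_matrix_vector_assoc[symmetric])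
  then have "\<bar>t - d $ k\<bar> * \<bar>u $ k\<bar> = \<bar>e\<bar> * \<bar>(E *v u) $ k\<bar>"
    by (simp add: abs_mult[symmetric] algebra_simps)
  also have "\<bar>(E *v u) $ k\<bar> \<le> norm (E *v u)"
    by (rule component_le_norm_cart)
  also have "norm (E *v u) \<le> onorm ((*v) E)"
    using onorm[OF matrix_vector_mul_bounded_linear, of E u] assms(2) by simp
  finally show ?thesis by (simp add: mult_left_mono)
qed

lemma unit_vector_tendsto_axis:
  fixes u :: "'x \<Rightarrow> real^'n"
  assumes "\<forall>\<^sub>F x in F. norm (u x) = 1 \<and> 0 \<le> u x $ i"
    and off: "\<And>k. k \<noteq> i \<Longrightarrow> ((\<lambda>x. u x $ k) \<longlongrightarrow> 0) F"
  shows "(u \<longlongrightarrow> axis i 1) F"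
proof (rule vec_tendstoI)
  fix k
  show "((\<lambda>x. u x $ k) \<longlongrightarrow> axis i 1 $ k) F"
  proof (cases "k = i")
    case True
    have "\<forall>\<^sub>F x in F. sqrt (1 - (\<Sum>k\<in>UNIV-{i}. (u x $ k)\<^sup>2)) = u x $ i"
      using assms(1)
    proof eventually_elim
      case (elim x)
      have "(norm (u x))\<^sup>2 = (u x $ i)\<^sup>2 + (\<Sum>k\<in>UNIV-{i}. (u x $ k)\<^sup>2)"
        by (simp add: norm_vec_def L2_set_def sum_nonneg sum.remove[of UNIV i])
      then have "1 - (\<Sum>k\<in>UNIV-{i}. (u x $ k)\<^sup>2) = (u x $ i)\<^sup>2" using elim by simp
      then show ?case using elim by simp
    qed
    moreover have "((\<lambda>x. sqrt (1 - (\<Sum>k\<in>UNIV-{i}. (u x $ k)\<^sup>2)))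
        \<longlongrightarrow> sqrt (1 - (\<Sum>k\<in>UNIV-{i}. 0\<^sup>2))) F"
      by (intro tendsto_intros off) auto
    ultimately have "((\<lambda>x. u x $ i) \<longlongrightarrow> sqrt (1 - (\<Sum>k\<in>UNIV-{i}. 0\<^sup>2))) F"
      by (rule Lim_transform_eventually[rotated])
    then show ?thesis using True by (simp add: axis_def)
  next
    case False
    then show ?thesis using off by (simp add: axis_def)
  qed
qed

lemma perturbed_eigenvector_tendsto:
  fixes E :: "real^'n^'n"
  assumes "0 < r" and separated: "\<And>k. k \<noteq> i \<Longrightarrow> 2 * r \<le> \<bar>d $ k - d $ i\<bar>"
    and eigenpair: "\<forall>\<^sub>F e in at 0. \<bar>t e - d $ i\<bar> \<le> r \<and> norm (u e) = 1 \<and> 0 \<le> u e $ i \<and>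
      (diag d + e *\<^sub>R E) *v u e = t e *\<^sub>R u e"
  shows "(u \<longlongrightarrow> axis i 1) (at 0)"
proof (rule unit_vector_tendsto_axis)
  show "\<forall>\<^sub>F e in at 0. norm (u e) = 1 \<and> 0 \<le> u e $ i"
    using eigenpair by eventually_elim simp
  fix k assume "k \<noteq> i"
  have "\<forall>\<^sub>F e in at 0. norm (u e $ k) \<le> \<bar>e\<bar> * (onorm ((*v) E) / r)"
    using eigenpair
  proof eventually_elim
    case (elim e)
    have "r \<le> \<bar>t e - d $ k\<bar>" using separated[OF \<open>k \<noteq> i\<close>] elim by linarith
    then have "r * \<bar>u e $ k\<bar> \<le> \<bar>t e - d $ k\<bar> * \<bar>u e $ k\<bar>" by (rule mult_right_mono) simp
    also have "\<dots> \<le> \<bar>e\<bar> * onorm ((*v) E)"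
      using elim by (intro perturbed_eigenvector_nth_le) auto
    finally show ?case using assms(1) by (simp add: field_simps)
  qed
  moreover have "((\<lambda>e. \<bar>e\<bar> * (onorm ((*v) E) / r)) \<longlongrightarrow> 0) (at 0)"
    using assms(1) by (auto intro!: tendsto_eq_intros)
  ultimately show "((\<lambda>e. u e $ k) \<longlongrightarrow> 0) (at 0)" by (rule Lim_null_comparison)
qed

lemma inj_nth_separated:
  fixes d :: "real^'n"
  assumes "inj (($) d)"
  obtains r where "0 < r" and "\<And>i k. i \<noteq> k \<Longrightarrow> r \<le> \<bar>d $ i - d $ k\<bar>"
proof -
  have "uniform_discrete (range (($) d))"
    using uniform_discrete_finite_iff[of "range (($) d)"] by simp
  then obtain r where "0 < r" "\<And>i k. dist (d $ i) (d $ k) < r \<Longrightarrow> d $ i = d $ k"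
    unfolding uniform_discrete_def by blast
  then show ?thesis
    using that assms by (metis dist_real_def injD not_le)
qed

lemma eigenvalues_tendsto:
  assumes "(A \<longlongrightarrow> diag d) F" and "(U \<longlongrightarrow> mat 1) F"
    and "\<forall>\<^sub>F x in F. orthogonally_diagonalizes (U x) (t x) (A x)"
  shows "(t \<longlongrightarrow> d) F"
proof (rule vec_tendstoI)
  fix i
  have "((\<lambda>x. transpose (U x) ** A x ** U x) \<longlongrightarrow> transpose (mat 1) ** diag d ** mat 1) F"
    by (intro tendsto_intros assms)
  then have "((\<lambda>x. (transpose (U x) ** A x ** U x) $ i $ i) \<longlongrightarrow> diag d $ i $ i) F"
    by (simp add: tendsto_vec_nth)
  moreover have "\<forall>\<^sub>F x in F. (transpose (U x) ** A x ** U x) $ i $ i = t x $ i"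
    using assms(3) by eventually_elim (simp add: orthogonally_diagonalizes_conjugate diag_def)
  ultimately show "((\<lambda>x. t x $ i) \<longlongrightarrow> d $ i) F"
    by (auto simp: diag_def intro: Lim_transform_eventually)
qed

definition normalized_eigenbasis_near ::
    "real \<Rightarrow> real^'n \<Rightarrow> real^'n^'n \<Rightarrow> real^'n \<Rightarrow> real^'n^'n \<Rightarrow> bool" where
  "normalized_eigenbasis_near r d A t U \<longleftrightarrow> (\<forall>i. \<bar>t $ i - d $ i\<bar> \<le> r \<and>
     norm (column i U) = 1 \<and> 0 \<le> column i U $ i \<and> A *v column i U = t $ i *\<^sub>R column i U)"

lemma eventually_normalized_eigenbasis_near:
  fixes E :: "real^'n^'n"
  assumes "0 < r" and "\<And>i k. i \<noteq> k \<Longrightarrow> r < \<bar>d $ i - d $ k\<bar>"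
  obtains t U where
    "\<forall>\<^sub>F e in at 0. normalized_eigenbasis_near r d (diag d + e *\<^sub>R E) (t e) (U e)"
proof -
  have "\<forall>\<^sub>F e in at 0. \<forall>i. \<exists>s u. \<bar>s - d $ i\<bar> \<le> r \<and> norm u = 1 \<and> 0 \<le> u $ i \<and>
      (diag d + e *\<^sub>R E) *v u = s *\<^sub>R u"
    using assms by (intro eventually_all_finite eventually_eigenpair_near_diagonal)
  then obtain s u where "\<forall>\<^sub>F e in at 0. \<forall>i. \<bar>s e i - d $ i\<bar> \<le> r \<and> norm (u e i) = 1 \<and>
      0 \<le> u e i $ i \<and> (diag d + e *\<^sub>R E) *v u e i = s e i *\<^sub>R u e i"
    unfolding choice_iff eventually_ex by blast
  then show ?thesis
    by (intro that[of "\<lambda>e. \<chi> i. s e i" "\<lambda>e. \<chi> k i. u e i $ k"])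
      (simp add: normalized_eigenbasis_near_def column_def)
qed

lemma normalized_eigenbasis_near_diagonalizes:
  assumes "normalized_eigenbasis_near r d A t U" and "transpose A = A"
    and separated: "\<And>i k. i \<noteq> k \<Longrightarrow> 2 * r < \<bar>d $ i - d $ k\<bar>"
  shows "orthogonally_diagonalizes U t A"
proof (rule eigenbasis_orthogonally_diagonalizes[OF assms(2)])
  have near: "\<bar>t $ i - d $ i\<bar> \<le> r" for i
    using assms(1) by (simp add: normalized_eigenbasis_near_def)
  have "t $ i \<noteq> t $ k" if "i \<noteq> k" for i k
    using separated[OF that] near[of i] near[of k] by linarith
  then show "inj (($) t)" by (auto intro: injI)
qed (use assms(1) in \<open>auto simp: normalized_eigenbasis_near_def\<close>)

lemma normalized_eigenbasis_near_tendsto: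
  fixes E :: "real^'n^'n"
  assumes "0 < r" and separated: "\<And>i k. i \<noteq> k \<Longrightarrow> 2 * r < \<bar>d $ i - d $ k\<bar>"
    and "\<forall>\<^sub>F e in at 0. normalized_eigenbasis_near r d (diag d + e *\<^sub>R E) (t e) (U e)"
  shows "(U \<longlongrightarrow> mat 1) (at 0)"
proof (intro vec_tendstoI)
  fix k i
  have "((\<lambda>e. column i (U e)) \<longlongrightarrow> axis i 1) (at 0)"
  proof (rule perturbed_eigenvector_tendsto[OF assms(1)])
    show "2 * r \<le> \<bar>d $ k - d $ i\<bar>" if "k \<noteq> i" for k
      using separated[OF that] by simp
    show "\<forall>\<^sub>F e in at 0. \<bar>t e $ i - d $ i\<bar> \<le> r \<and> norm (column i (U e)) = 1 \<and>
        0 \<le> column i (U e) $ i \<and>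
        (diag d + e *\<^sub>R E) *v column i (U e) = t e $ i *\<^sub>R column i (U e)"
      using assms(3) by eventually_elim (simp add: normalized_eigenbasis_near_def)
  qed
  from tendsto_vec_nth[OF this, of k]
  show "((\<lambda>e. U e $ k $ i) \<longlongrightarrow> mat 1 $ k $ i) (at 0)"
    by (simp add: column_def mat_def axis_def eq_commute)
qed

lemma perturbed_diagonal_eigenbasis:
  fixes E :: "real^'n^'n"
  assumes "inj (($) d)" and "transpose E = E"
  obtains t U where "(t \<longlongrightarrow> d) (at 0)" and "(U \<longlongrightarrow> mat 1) (at 0)"
    and "\<forall>\<^sub>F e in at 0. orthogonally_diagonalizes (U e) (t e) (diag d + e *\<^sub>R E)"
proof -
  obtain g where g: "0 < g" "\<And>i k. i \<noteq> k \<Longrightarrow> g \<le> \<bar>d $ i - d $ k\<bar>"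
    using inj_nth_separated[OF assms(1)] by blast
  define r where "r = g / 3"
  have "0 < r" using g(1) by (simp add: r_def)
  have separated: "2 * r < \<bar>d $ i - d $ k\<bar>" if "i \<noteq> k" for i k
    using g(1) g(2)[OF that] by (simp add: r_def)
  have "r < \<bar>d $ i - d $ k\<bar>" if "i \<noteq> k" for i k
    using \<open>0 < r\<close> separated[OF that] by linarith
  then obtain t U where
    near: "\<forall>\<^sub>F e in at 0. normalized_eigenbasis_near r d (diag d + e *\<^sub>R E) (t e) (U e)"
    by (rule eventually_normalized_eigenbasis_near[OF \<open>0 < r\<close>])
  have lim_U: "(U \<longlongrightarrow> mat 1) (at 0)"
    by (rule normalized_eigenbasis_near_tendsto[OF \<open>0 < r\<close> separated near])
  have "transpose (diag d + e *\<^sub>R E) = diag d + e *\<^sub>R E" for e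
    using assms(2) by (simp add: transpose_def diag_def vec_eq_iff)
  then have diagonalizes: "\<forall>\<^sub>F e in at 0. orthogonally_diagonalizes (U e) (t e) (diag d + e *\<^sub>R E)"
    using near
    by (auto elim!: eventually_mono intro: normalized_eigenbasis_near_diagonalizes separated)
  have "((\<lambda>e. diag d + e *\<^sub>R E) \<longlongrightarrow> diag d) (at 0)"
    by (auto intro!: tendsto_eq_intros)
  then have "(t \<longlongrightarrow> d) (at 0)"
    by (rule eigenvalues_tendsto[OF _ lim_U diagonalizes])
  then show ?thesis by (rule that[OF _ lim_U diagonalizes])
qed

section \<open>Complementary Gram factors\<close>

lemma mult_transpose_nth: "(A ** transpose B) $ i $ j = A $ i \<bullet> B $ j" for A B :: "real^'n^_"
  by (simp add: matrix_matrix_mult_def transpose_def inner_vec_def)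

lemma gram_row_eq_zero:
  fixes Y :: "real^'n^'m"
  assumes "(Y ** transpose Y) $ k = 0"
  shows "Y $ k = 0"
  using arg_cong[OF assms, of "\<lambda>y. y $ k"] by (simp add: mult_transpose_nth)

lemma eventually_eigenvalues_nonneg:
  assumes "(t \<longlongrightarrow> d) F" and "(U \<longlongrightarrow> mat 1) F"
    and "\<forall>\<^sub>F x in F. orthogonally_diagonalizes (U x) (t x) (A x)"
    and "\<And>x. A x $ k = 0" and "\<And>i. i \<noteq> k \<Longrightarrow> 0 < d $ i"
  shows "\<forall>\<^sub>F x in F. 0 \<le> t x $ i"
proof (cases "i = k")
  case True
  have "((\<lambda>x. U x $ k $ k) \<longlongrightarrow> 1) F"
    using tendsto_vec_nth[OF tendsto_vec_nth[OF assms(2)], of k k] by (simp add: mat_def)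
  then have "\<forall>\<^sub>F x in F. U x $ k $ k \<noteq> 0"
    by (rule tendsto_imp_eventually_ne) simp
  with assms(3) show ?thesis
    by eventually_elim (simp add: True eigenvalue_eq_zero[OF _ assms(4)])
next
  case False
  have "\<forall>\<^sub>F x in F. 0 < t x $ i"
    by (rule order_tendstoD(1)[OF tendsto_vec_nth[OF assms(1)] assms(5)[OF False]])
  then show ?thesis by eventually_elim simp
qed

lemma eventually_sqrt_factors_mult_nonzero:
  assumes "(t \<longlongrightarrow> \<alpha>) F" and "(U \<longlongrightarrow> mat 1) F"
    and "(s \<longlongrightarrow> \<mu>) F" and "(V \<longlongrightarrow> mat 1) F" and "(W \<longlongrightarrow> W0) F"
    and "0 < \<alpha> $ a" and "0 < \<mu> $ b" and "W0 $ a $ b \<noteq> 0"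
  shows "\<forall>\<^sub>F x in F. (sqrt_factor (t x) (U x) (mat 1) **
    transpose (sqrt_factor (s x) (V x) (W x))) $ a $ b \<noteq> 0"
proof (rule tendsto_imp_eventually_ne)
  show "((\<lambda>x. (sqrt_factor (t x) (U x) (mat 1) ** transpose (sqrt_factor (s x) (V x) (W x))) $ a $ b)
      \<longlongrightarrow> (sqrt_factor \<alpha> (mat 1) (mat 1) ** transpose (sqrt_factor \<mu> (mat 1) W0)) $ a $ b) F"
    by (intro tendsto_intros assms)
  have "sqrt_factor \<alpha> (mat 1) (mat 1) ** transpose (sqrt_factor \<mu> (mat 1) W0)
      = diag (\<chi> i. sqrt (\<alpha> $ i)) ** (W0 ** diag (\<chi> i. sqrt (\<mu> $ i)))"
    by (simp add: transpose_sqrt_factor) (simp add: sqrt_factor_def)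
  then show "(sqrt_factor \<alpha> (mat 1) (mat 1) ** transpose (sqrt_factor \<mu> (mat 1) W0)) $ a $ b \<noteq> 0"
    using assms(6-8) by (simp add: diag_mult_nth mult_diag_nth)
qed

lemma interlacing_sqrt_factors:
  assumes A: "orthogonally_diagonalizes U t A" and C: "orthogonally_diagonalizes V s C"
    and interlacing: "interlacing (\<chi> i. c - t $ i) s"
    and nonneg: "\<And>i. 0 \<le> t $ i" "\<And>i. 0 \<le> s $ i"
  defines "z \<equiv> secular_root (\<chi> i. c - t $ i) s"
    and "X \<equiv> sqrt_factor t U (mat 1)"
    and "Y \<equiv> sqrt_factor s V (secular_matrix (\<chi> i. c - t $ i) s)"
  shows "X ** transpose X = A" and "Y ** transpose Y = C"
    and "transpose X ** X + transpose Y ** Y = mat c + outer z z"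
proof -
  have W: "orthogonally_diagonalizes (secular_matrix (\<chi> i. c - t $ i) s) s
      (diag (\<chi> i. c - t $ i) + outer z z)"
    unfolding z_def by (rule secular_matrix_orthogonally_diagonalizes[OF interlacing])
  show "X ** transpose X = A"
    unfolding X_def by (rule sqrt_factor_mult_transpose[OF A orthogonal_matrix_id nonneg(1)])
  show "Y ** transpose Y = C"
    unfolding Y_def using W nonneg(2)
    by (intro sqrt_factor_mult_transpose[OF C]) (auto simp: orthogonally_diagonalizes_def)
  have "transpose X ** X = diag t"
    using sqrt_factor_mult_transpose[OF diag_orthogonally_diagonalizes, of U t] A nonneg(1)
    by (simp add: X_def transpose_sqrt_factor orthogonally_diagonalizes_def)
  moreover have "transpose Y ** Y = diag (\<chi> i. c - t $ i) + outer z z"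
    using sqrt_factor_mult_transpose[OF W, of V] C nonneg(2)
    by (simp add: Y_def transpose_sqrt_factor orthogonally_diagonalizes_def)
  ultimately show "transpose X ** X + transpose Y ** Y = mat c + outer z z"
    by (simp add: vec_eq_iff diag_def mat_def)
qed

definition complementary_factors :: "'n \<Rightarrow> real^'n^'n \<Rightarrow> real^'n^'n \<Rightarrow> bool" where
  "complementary_factors k X Y \<longleftrightarrow>
     (\<exists>c z. transpose X ** X + transpose Y ** Y = mat c + outer z z) \<and> Y $ k = 0 \<and>
     (\<forall>i j. j \<noteq> k \<longrightarrow> (X ** transpose Y) $ i $ j \<noteq> 0)"

lemma eventually_interlacing_sqrt_factors:
  fixes \<alpha> \<mu> :: "real^'n"
  assumes lim: "(t \<longlongrightarrow> \<alpha>) F" "(U \<longlongrightarrow> mat 1) F" "(s \<longlongrightarrow> \<mu>) F" "(V \<longlongrightarrow> mat 1) F"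
    and A: "\<forall>\<^sub>F x in F. orthogonally_diagonalizes (U x) (t x) (A x)"
    and C: "\<forall>\<^sub>F x in F. orthogonally_diagonalizes (V x) (s x) (C x)" and C_k: "\<And>x. C x $ k = 0"
    and interlacing: "interlacing (\<chi> i. c - \<alpha> $ i) \<mu>"
    and \<alpha>_pos: "\<And>i. 0 < \<alpha> $ i" and \<mu>_pos: "\<And>i. i \<noteq> k \<Longrightarrow> 0 < \<mu> $ i"
  shows "\<forall>\<^sub>F x in F. \<exists>X Y. X ** transpose X = A x \<and> Y ** transpose Y = C x \<and>
    complementary_factors k X Y"
proof -
  define \<delta> where "\<delta> x = (\<chi> i. c - t x $ i)" for x
  define X where "X x = sqrt_factor (t x) (U x) (mat 1)" for x
  define Y where "Y x = sqrt_factor (s x) (V x) (secular_matrix (\<delta> x) (s x))" for x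
  have \<delta>: "(\<delta> \<longlongrightarrow> (\<chi> i. c - \<alpha> $ i)) F"
    unfolding \<delta>_def by (intro tendsto_intros lim)
  have "\<forall>\<^sub>F x in F. interlacing (\<delta> x) (s x)"
    by (rule interlacing_eventually[OF \<delta> lim(3) interlacing])
  moreover have "\<forall>\<^sub>F x in F. \<forall>i. 0 < t x $ i"
    by (intro eventually_all_finite order_tendstoD(1)[OF tendsto_vec_nth[OF lim(1)] \<alpha>_pos])
  moreover have "\<forall>\<^sub>F x in F. \<forall>i. 0 \<le> s x $ i"
    by (intro eventually_all_finite eventually_eigenvalues_nonneg[OF lim(3,4) C C_k \<mu>_pos])
  moreover have "\<forall>\<^sub>F x in F. j \<noteq> k \<longrightarrow> (X x ** transpose (Y x)) $ i $ j \<noteq> 0" for i j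
    unfolding X_def Y_def
    using eventually_sqrt_factors_mult_nonzero[OF lim tendsto_secular_matrix[OF \<delta> lim(3) interlacing]
        \<alpha>_pos \<mu>_pos secular_matrix_nth_nonzero[OF interlacing]]
    by (cases "j = k") simp_all
  then have "\<forall>\<^sub>F x in F. \<forall>i j. j \<noteq> k \<longrightarrow> (X x ** transpose (Y x)) $ i $ j \<noteq> 0"
    by (intro eventually_all_finite)
  ultimately show ?thesis
    using A C
  proof eventually_elim
    case (elim x)
    then have nonneg: "0 \<le> t x $ i" "0 \<le> s x $ i" for i by (simp_all add: less_imp_le)
    note factors = interlacing_sqrt_factors[OF elim(5,6) elim(1)[unfolded \<delta>_def] nonneg,
        folded \<delta>_def, folded X_def Y_def]
    have "Y x $ k = 0" using gram_row_eq_zero factors(2) C_k by metis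
    then have "complementary_factors k (X x) (Y x)"
      using factors(3) elim(4) unfolding complementary_factors_def by blast
    with factors(1,2) show ?case by blast
  qed
qed

lemma interlacing_spectra_exist:
  fixes k :: "'v::finite"
  obtains c and \<alpha> \<mu> :: "real^'v" where "interlacing (\<chi> i. c - \<alpha> $ i) \<mu>"
    and "\<And>i. 0 < \<alpha> $ i" and "\<And>i. i \<noteq> k \<Longrightarrow> 0 < \<mu> $ i" and "\<mu> $ k = 0"
proof -
  obtain g :: "'v \<Rightarrow> nat" where "inj g"
    using finite_imp_inj_to_nat_seg[of "UNIV :: 'v set"] by auto
  define h where "h i = (if i = k then 0 else Suc (g i))" for i
  have h: "inj h" using \<open>inj g\<close> by (auto simp: inj_def h_def)
  define c where "c = 2 * real (Max (range h))"
  define \<alpha> :: "real^'v" where "\<alpha> = (\<chi> i. c - (2 * real (h i) - 1))"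
  define \<mu> :: "real^'v" where "\<mu> = (\<chi> i. 2 * real (h i))"
  show ?thesis
  proof
    show "interlacing (\<chi> i. c - \<alpha> $ i) \<mu>"
      unfolding interlacing_def
    proof (intro conjI allI impI)
      fix i j :: 'v
      assume "i \<noteq> j"
      then have "h i < h j \<or> h j < h i" using h by (metis injD linorder_neqE_nat)
      then show "\<mu> $ i < (\<chi> i. c - \<alpha> $ i) $ j \<or> \<mu> $ j < (\<chi> i. c - \<alpha> $ i) $ i"
        by (auto simp: \<alpha>_def \<mu>_def)
    qed (simp add: \<alpha>_def \<mu>_def)
    fix i
    have "real (h i) \<le> real (Max (range h))" by simp
    then have "2 * real (h i) - 1 < c" unfolding c_def by linarith
    then show "0 < \<alpha> $ i" by (simp add: \<alpha>_def)
  qed (auto simp: \<mu>_def h_def)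
qed

section \<open>Joins of graphs\<close>

definition adjacency :: "('v::finite \<times> 'v) set \<Rightarrow> real^'v^'v" where
  "adjacency E = (\<chi> a b. if (a, b) \<in> E then 1 else 0)"

lemma transpose_adjacency: "simple_graph E \<Longrightarrow> transpose (adjacency E) = adjacency E"
  by (auto simp: adjacency_def transpose_def vec_eq_iff simple_graph_def sym_def)

lemma diag_plus_adjacency_in_graph_matrices:
  assumes "simple_graph E" and "e \<noteq> 0"
  shows "diag d + e *\<^sub>R adjacency E \<in> graph_matrices E"
  using assms
  by (auto simp: graph_matrices_def transpose_def vec_eq_iff diag_def adjacency_def
      simple_graph_def sym_def)

lemma isolated_vertex_complementary_factors:
  fixes G H :: "('v::finite \<times> 'v) set"
  assumes "simple_graph G" and "simple_graph H" and isolated: "\<And>i. (k, i) \<notin> H"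
  obtains X Y where "X ** transpose X \<in> graph_matrices G" and "Y ** transpose Y \<in> graph_matrices H"
    and "complementary_factors k X Y"
proof -
  obtain c and \<alpha> \<mu> :: "real^'v" where interlacing: "interlacing (\<chi> i. c - \<alpha> $ i) \<mu>"
    and pos: "\<And>i. 0 < \<alpha> $ i" "\<And>i. i \<noteq> k \<Longrightarrow> 0 < \<mu> $ i" and "\<mu> $ k = 0"
    using interlacing_spectra_exist[of k] by blast
  define A where "A e = diag \<alpha> + e *\<^sub>R adjacency G" for e
  define C where "C e = diag \<mu> + e *\<^sub>R adjacency H" for e
  have inj: "inj (($) \<alpha>)" "inj (($) \<mu>)"
    using interlacing_distinct[OF interlacing] by (auto simp: inj_def)
  obtain t U where A: "(t \<longlongrightarrow> \<alpha>) (at 0)" "(U \<longlongrightarrow> mat 1) (at 0)"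
      "\<forall>\<^sub>F e in at 0. orthogonally_diagonalizes (U e) (t e) (A e)"
    unfolding A_def
    by (rule perturbed_diagonal_eigenbasis[OF inj(1) transpose_adjacency[OF assms(1)]])
  obtain s V where C: "(s \<longlongrightarrow> \<mu>) (at 0)" "(V \<longlongrightarrow> mat 1) (at 0)"
      "\<forall>\<^sub>F e in at 0. orthogonally_diagonalizes (V e) (s e) (C e)"
    unfolding C_def
    by (rule perturbed_diagonal_eigenbasis[OF inj(2) transpose_adjacency[OF assms(2)]])
  have C_k: "C e $ k = 0" for e
    using isolated \<open>\<mu> $ k = 0\<close> by (auto simp: C_def vec_eq_iff diag_def adjacency_def)
  have "\<forall>\<^sub>F e in at 0. e \<noteq> 0 \<and>
      (\<exists>X Y. X ** transpose X = A e \<and> Y ** transpose Y = C e \<and> complementary_factors k X Y)"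
    by (intro eventually_conj eventually_neq_at_within
        eventually_interlacing_sqrt_factors[OF A(1,2) C(1,2) A(3) C(3) C_k interlacing pos])
  then obtain e X Y where "e \<noteq> 0" and gram: "X ** transpose X = A e" "Y ** transpose Y = C e"
    and factors: "complementary_factors k X Y"
    using eventually_happens'[OF at_neq_bot] by blast
  have "X ** transpose X \<in> graph_matrices G" "Y ** transpose Y \<in> graph_matrices H"
    unfolding gram A_def C_def
    by (intro diag_plus_adjacency_in_graph_matrices assms(1,2) \<open>e \<noteq> 0\<close>)+
  then show ?thesis using factors by (rule that)
qed

definition stack :: "real^'n^'a \<Rightarrow> real^'n^'b \<Rightarrow> real^'n^('a::finite + 'b::finite)" where
  "stack X Y = (\<chi> p. case_sum (($) X) (($) Y) p)"

lemma stack_nth [simp]: "stack X Y $ Inl a = X $ a" "stack X Y $ Inr b = Y $ b"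
  by (simp_all add: stack_def)

definition select_rows :: "('b \<Rightarrow> 'a) \<Rightarrow> real^'n^'a \<Rightarrow> real^'n^'b" where
  "select_rows \<iota> Y = (\<chi> b. Y $ \<iota> b)"

lemma select_rows_nth [simp]: "select_rows \<iota> Y $ b = Y $ \<iota> b"
  by (simp add: select_rows_def)

lemma graph_join_iff [simp]:
  "(Inl a, Inl a') \<in> graph_join G G' \<longleftrightarrow> (a, a') \<in> G"
  "(Inr b, Inr b') \<in> graph_join G G' \<longleftrightarrow> (b, b') \<in> G'"
  "(Inl a, Inr b) \<in> graph_join G G'"
  "(Inr b, Inl a) \<in> graph_join G G'"
  by (auto simp: graph_join_def)

lemma gram_in_graph_matrices_iff:
  fixes K :: "real^'n^'v"
  shows "K ** transpose K \<in> graph_matrices E \<longleftrightarrow>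
    (\<forall>i j. i \<noteq> j \<longrightarrow> (K $ i \<bullet> K $ j \<noteq> 0 \<longleftrightarrow> (i, j) \<in> E))"
  by (simp add: graph_matrices_def matrix_transpose_mul mult_transpose_nth)

lemma gram_stack_in_graph_matrices_join:
  fixes X :: "real^'n^'a" and Y :: "real^'n^'b"
  assumes "X ** transpose X \<in> graph_matrices G" and "Y ** transpose Y \<in> graph_matrices G'"
    and "\<And>a b. (X ** transpose Y) $ a $ b \<noteq> 0"
  shows "stack X Y ** transpose (stack X Y) \<in> graph_matrices (graph_join G G')"
  unfolding gram_in_graph_matrices_iff
proof (intro allI impI)
  fix p q :: "'a + 'b"
  assume "p \<noteq> q"
  then show "stack X Y $ p \<bullet> stack X Y $ q \<noteq> 0 \<longleftrightarrow> (p, q) \<in> graph_join G G'"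
    using assms by (cases p; cases q)
      (auto simp: gram_in_graph_matrices_iff mult_transpose_nth inner_commute)
qed

lemma gram_select_rows_in_graph_matrices:
  fixes Y :: "real^'n^'v" and \<iota> :: "'b::finite \<Rightarrow> 'v"
  assumes "inj \<iota>" and "Y ** transpose Y \<in> graph_matrices (map_prod \<iota> \<iota> ` E)"
  shows "select_rows \<iota> Y ** transpose (select_rows \<iota> Y) \<in> graph_matrices E"
proof -
  have "(\<iota> b, \<iota> b') \<in> map_prod \<iota> \<iota> ` E \<longleftrightarrow> (b, b') \<in> E" for b b'
    using inj_image_mem_iff[OF prod.inj_map[OF assms(1) assms(1)], of "(b, b')"] by simp
  then have "Y $ \<iota> b \<bullet> Y $ \<iota> b' \<noteq> 0 \<longleftrightarrow> (b, b') \<in> E" if "b \<noteq> b'" for b b'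
    using that assms unfolding gram_in_graph_matrices_iff by (metis injD)
  then show ?thesis by (simp add: gram_in_graph_matrices_iff)
qed

lemma transpose_mult_self_vector:
  fixes K :: "real^'n^'m"
  shows "(transpose K ** K) *v v = (\<Sum>i\<in>UNIV. (K $ i \<bullet> v) *\<^sub>R K $ i)"
proof -
  have "transpose K *v (K *v v) = (\<Sum>i\<in>UNIV. (K *v v) $ i *s transpose (transpose K) $ i)"
    by (rule matrix_vector_column)
  then show ?thesis
    by (simp add: matrix_vector_mul_assoc matrix_vector_mul_component scalar_mult_eq_scaleR
        del: transpose_matrix_vector)
qed

lemma gram_stack_select_rows_vector:
  fixes X :: "real^'n^'a" and Y :: "real^'n^'v" and \<iota> :: "'b::finite \<Rightarrow> 'v"
  assumes "inj \<iota>"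
  defines "K \<equiv> stack X (select_rows \<iota> Y)"
  shows "(transpose K ** K) *v v = (transpose X ** X + transpose Y ** Y) *v v
    - (\<Sum>i\<in>- range \<iota>. (Y $ i \<bullet> v) *\<^sub>R Y $ i)"
proof -
  have "(\<Sum>p\<in>UNIV. (K $ p \<bullet> v) *\<^sub>R K $ p)
      = (\<Sum>a\<in>UNIV. (X $ a \<bullet> v) *\<^sub>R X $ a) + (\<Sum>i\<in>range \<iota>. (Y $ i \<bullet> v) *\<^sub>R Y $ i)"
    by (simp add: K_def UNIV_Plus_UNIV[symmetric] sum.Plus sum.reindex[OF assms(1)]
        del: UNIV_Plus_UNIV)
  also have "(\<Sum>i\<in>range \<iota>. (Y $ i \<bullet> v) *\<^sub>R Y $ i)
      = (\<Sum>i\<in>UNIV. (Y $ i \<bullet> v) *\<^sub>R Y $ i) - (\<Sum>i\<in>- range \<iota>. (Y $ i \<bullet> v) *\<^sub>R Y $ i)"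
    by (simp add: Compl_eq_Diff_UNIV sum_diff)
  finally show ?thesis
    by (simp add: transpose_mult_self_vector matrix_vector_mult_add_rdistrib)
qed

lemma rank_gram_stack_select_rows_le:
  fixes X :: "real^'n^'a" and Y :: "real^'n^'v" and \<iota> :: "'b::finite \<Rightarrow> 'v"
  assumes gram: "transpose X ** X + transpose Y ** Y = mat c + outer z z"
    and "inj \<iota>" and "k \<notin> range \<iota>" and "Y $ k = 0"
  defines "K \<equiv> stack X (select_rows \<iota> Y)"
  shows "rank (transpose K ** K - mat c) \<le> CARD('v) - CARD('b)"
proof -
  define S where "S = - range \<iota> - {k}"
  have "(transpose K ** K - mat c) *v v \<in> span (insert z (($) Y ` S))" for v
  proof -
    have "(transpose K ** K - mat c) *v v
        = (z \<bullet> v) *\<^sub>R z - (\<Sum>i\<in>- range \<iota>. (Y $ i \<bullet> v) *\<^sub>R Y $ i)"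
      by (simp add: K_def gram_stack_select_rows_vector[OF assms(2)] gram outer_mult_vector
          matrix_vector_mult_add_rdistrib matrix_vector_mult_diff_rdistrib)
    also have "(\<Sum>i\<in>- range \<iota>. (Y $ i \<bullet> v) *\<^sub>R Y $ i) = (\<Sum>i\<in>S. (Y $ i \<bullet> v) *\<^sub>R Y $ i)"
      using assms(3,4) by (simp add: S_def sum.remove[of _ k])
    also have "(z \<bullet> v) *\<^sub>R z - \<dots> \<in> span (insert z (($) Y ` S))"
      by (intro span_diff span_mul span_sum) (auto intro: span_base)
    finally show ?thesis .
  qed
  then have "rank (transpose K ** K - mat c) \<le> card (insert z (($) Y ` S))"
    unfolding rank_dim_range by (intro dim_le_card) auto
  also have "\<dots> \<le> Suc (card S)"
    using card_insert_le_m1[of "Suc (card S)" "($) Y ` S" z] card_image_le[of S "($) Y"] by simp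
  also have "Suc (card S) = card (- range \<iota>)"
    unfolding S_def using assms(3) by (intro card_Suc_Diff1) auto
  also have "\<dots> = CARD('v) - CARD('b)"
    by (simp add: Compl_eq_Diff_UNIV card_Diff_subset card_image[OF assms(2)])
  finally show ?thesis .
qed

lemma q_graph_le: "A \<in> graph_matrices E \<Longrightarrow> q_graph E \<le> q_matrix A"
  unfolding q_graph_def by (intro cINF_lower) auto

lemma q_graph_join_le:
  fixes X Y :: "real^'v^'v" and \<iota> :: "'b::finite \<Rightarrow> 'v"
  assumes X: "X ** transpose X \<in> graph_matrices G"
    and Y: "Y ** transpose Y \<in> graph_matrices (map_prod \<iota> \<iota> ` G')"
    and "complementary_factors k X Y" and "inj \<iota>" and "k \<notin> range \<iota>"
  shows "q_graph (graph_join G G') \<le> 2 + (CARD('v) - CARD('b))"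
proof -
  obtain c z where gram: "transpose X ** X + transpose Y ** Y = mat c + outer z z" "Y $ k = 0"
    and nonzero: "\<And>i j. j \<noteq> k \<Longrightarrow> (X ** transpose Y) $ i $ j \<noteq> 0"
    using assms(3) by (auto simp: complementary_factors_def)
  define K where "K = stack X (select_rows \<iota> Y)"
  have "(X ** transpose (select_rows \<iota> Y)) $ i $ b \<noteq> 0" for i b
  proof -
    have "\<iota> b \<noteq> k" using \<open>k \<notin> range \<iota>\<close> by blast
    then show ?thesis using nonzero[of "\<iota> b" i] by (simp add: mult_transpose_nth)
  qed
  then have "K ** transpose K \<in> graph_matrices (graph_join G G')"
    unfolding K_def
    by (intro gram_stack_in_graph_matrices_join X gram_select_rows_in_graph_matrices[OF \<open>inj \<iota>\<close> Y])
  then have "q_graph (graph_join G G') \<le> q_matrix (K ** transpose K)" by (rule q_graph_le)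
  also have "\<dots> \<le> 2 + rank (transpose K ** K - mat c)" by (rule q_matrix_gram_le)
  also have "rank (transpose K ** K - mat c) \<le> CARD('v) - CARD('b)"
    unfolding K_def by (rule rank_gram_stack_select_rows_le[OF gram(1) assms(4,5) gram(2)])
  finally show ?thesis by simp
qed

lemma simple_graph_image:
  assumes "inj \<iota>" and "simple_graph E"
  shows "simple_graph (map_prod \<iota> \<iota> ` E)"
  using assms by (fastforce simp: simple_graph_def sym_def irrefl_def dest: injD)

theorem theorem4p6:
  fixes G :: "('a::finite \<times> 'a) set" and G' :: "('b::finite \<times> 'b) set"
    and n l :: nat
  assumes "simple_graph G" and "simple_graph G'"
    and "connected_graph G" and "connected_graph G'"
    and "CARD('a) = n" and "CARD('b) = n - l"
    and "1 \<le> l" and "l < n"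
  shows "q_graph (graph_join G G') \<le> 2 + l"
proof -
  fix k :: 'a
  have "card (UNIV :: 'b set) \<le> card (UNIV - {k})"
    using assms(5-8) by (simp add: card_Diff_singleton)
  then obtain \<iota> :: "'b \<Rightarrow> 'a" where \<iota>: "inj \<iota>" "k \<notin> range \<iota>"
    using card_le_inj[of "UNIV :: 'b set" "UNIV - {k}"] by auto
  have "simple_graph (map_prod \<iota> \<iota> ` G')"
    by (rule simple_graph_image[OF \<iota>(1) assms(2)])
  moreover have "(k, i) \<notin> map_prod \<iota> \<iota> ` G'" for i
    using \<iota>(2) by auto
  ultimately have "q_graph (graph_join G G') \<le> 2 + (CARD('a) - CARD('b))"
    by (rule isolated_vertex_complementary_factors[OF assms(1)])
      (rule q_graph_join_le[OF _ _ _ \<iota>])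
  then show ?thesis using assms(5-8) by simp
qed

end
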